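(* Call a finite digraph $D$ on $n$ vertices good if $D$ has a quasi-kernel $K$ with $|K|\le \frac{n+|S|-|N_D^+(S)|}{2}$, where $S$ is the set of sources of $D$ (vertices of indegree $0$) and $N_D^+(S)=\bigl(\bigcup_{x\in S}N_D^+(x)\bigr)\setminus S$. If there exists a digraph that is not good, and $D$ is a digraph that is not good with the minimum number of vertices among all digraphs that are not good, then $D$ has no source.
   Context: Digraphs are finite, have no loops, and may contain antiparallel arcs. For a vertex $x$, $N_D^+(x)=\{y: xy\in A(D)\}$. A set $K\subseteq V(D)$ is independent if no arc of $D$ joins two vertices of $K$. The distance ${\rm dist}_D(u,v)$ is the length of a shortest directed path from $u$ to $v$, and ${\rm dist}_D(K,v)=\min_{x\in K}{\rm dist}_D(x,v)$. A quasi-kernel of $D$ is an independent set $K$ with ${\rm dist}_D(K,v)\le 2$ for every $v\in V(D)\setminus K$. *)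

theory Defs
  imports "Graph_Theory.Graph_Theory"
begin

(* Finite loopless digraphs without parallel arcs are those satisfying the locale
   predicate "digraph" of Graph_Theory; antiparallel arcs are allowed there, and so is
   the digraph without vertices. *)

(* The library's infimum of walk costs with unit weights. All costs are nonnegative,
   so taking walks instead of paths does not matter; the value is \<infinity> if there is
   no walk. *)
definition vdist :: "('a, 'b) pre_digraph \<Rightarrow> 'a \<Rightarrow> 'a \<Rightarrow> ereal" where
  "vdist G u v = wf_digraph.\<mu> G (\<lambda>_. 1) u v"

(* \<infinity> for empty K. *)
definition set_vdist :: "('a, 'b) pre_digraph \<Rightarrow> 'a set \<Rightarrow> 'a \<Rightarrow> ereal" where
  "set_vdist G K v = (INF x\<in>K. vdist G x v)"

definition independent_verts :: "('a, 'b) pre_digraph \<Rightarrow> 'a set \<Rightarrow> bool" where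
  "independent_verts G K \<longleftrightarrow> K \<subseteq> verts G \<and> (\<forall>u\<in>K. \<forall>v\<in>K. \<not> u \<rightarrow>\<^bsub>G\<^esub> v)"

definition quasi_kernel :: "('a, 'b) pre_digraph \<Rightarrow> 'a set \<Rightarrow> bool" where
  "quasi_kernel G K \<longleftrightarrow>
     independent_verts G K \<and> (\<forall>v \<in> verts G - K. set_vdist G K v \<le> 2)"

definition sources :: "('a, 'b) pre_digraph \<Rightarrow> 'a set" where
  "sources G = {v \<in> verts G. in_degree G v = 0}"

definition out_nbrs :: "('a, 'b) pre_digraph \<Rightarrow> 'a \<Rightarrow> 'a set" where
  "out_nbrs G x = {y. x \<rightarrow>\<^bsub>G\<^esub> y}"

definition out_nbrs_set :: "('a, 'b) pre_digraph \<Rightarrow> 'a set \<Rightarrow> 'a set" where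
  "out_nbrs_set G S = (\<Union>x\<in>S. out_nbrs G x) - S"

definition good :: "('a, 'b) pre_digraph \<Rightarrow> bool" where
  "good G \<longleftrightarrow> (\<exists>K. quasi_kernel G K \<and>
     real (card K) \<le>
       (real (card (verts G)) + real (card (sources G))
          - real (card (out_nbrs_set G (sources G)))) / 2)"

(* Being good is invariant under isomorphism, and every digraph has an isomorphic copy
   whose vertices are natural numbers and whose arcs are pairs of them. So a minimum over
   all digraphs may be taken over this one type. *)

lemma good_app_iso:
  fixes G :: "('a, 'b) pre_digraph"
    and hom :: "('a, 'b, 'c, 'd) digraph_isomorphism"
  assumes G: "wf_digraph G" and hom: "pre_digraph.digraph_isomorphism G hom"
    and "good G"
  shows "good (app_iso hom G)"
proof -
  interpret wf_digraph G by fact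
  interpret H: wf_digraph "app_iso hom G" using hom ..
  let ?f = "iso_verts hom" and ?H = "app_iso hom G"
  have inj: "inj_on ?f (verts G)"
    using hom by (rule digraph_isomorphism_inj_on_verts)
  have dom: "?f u \<rightarrow>\<^bsub>?H\<^esub> ?f v \<longleftrightarrow> u \<rightarrow>\<^bsub>G\<^esub> v"
    if "u \<in> verts G" "v \<in> verts G" for u v
    using that adj_in_verts inj unfolding arcs_ends_app_iso_eq[OF hom]
    by (auto simp: inj_on_eq_iff intro!: rev_image_eqI[of "(u, v)"])
  have dist: "vdist ?H (?f u) (?f v) \<le> vdist G u v" for u v
    unfolding vdist_def \<mu>_def
  proof (rule INF_greatest)
    fix p assume "p \<in> {p. awalk u p v}"
    then have "H.awalk (?f u) (map (iso_arcs hom) p) (?f v)"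
      using hom by (auto intro: awalk_app_isoI)
    from H.min_cost_le_walk_cost[OF this, of "\<lambda>_. 1"]
    show "H.\<mu> (\<lambda>_. 1) (?f u) (?f v) \<le> ereal (awalk_cost (\<lambda>_. 1) p)"
      by (simp add: awalk_cost_def H.awalk_cost_def o_def)
  qed
  have src: "sources ?H = ?f ` sources G"
    using hom by (auto simp: sources_def in_degree_app_iso_eq)
  have nbr: "out_nbrs_set ?H (sources ?H) = ?f ` out_nbrs_set G (sources G)"
  proof -
    have *: "(\<Union>x\<in>?f ` S. out_nbrs ?H x) = ?f ` (\<Union>x\<in>S. out_nbrs G x)"
      if "S \<subseteq> verts G" for S
    proof (intro equalityI subsetI)
      fix y assume "y \<in> (\<Union>x\<in>?f ` S. out_nbrs ?H x)"
      then obtain x where x: "x \<in> S" "?f x \<rightarrow>\<^bsub>?H\<^esub> y" by (auto simp: out_nbrs_def)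
      then obtain z where z: "z \<in> verts G" "y = ?f z"
        using H.adj_in_verts(2)[OF x(2)] by auto
      then have "x \<rightarrow>\<^bsub>G\<^esub> z" using x that dom by auto
      with x z show "y \<in> ?f ` (\<Union>x\<in>S. out_nbrs G x)"
        unfolding out_nbrs_def by blast
    next
      fix y assume "y \<in> ?f ` (\<Union>x\<in>S. out_nbrs G x)"
      then obtain x z where x: "x \<in> S" "x \<rightarrow>\<^bsub>G\<^esub> z" "y = ?f z" by (auto simp: out_nbrs_def)
      then have "?f x \<rightarrow>\<^bsub>?H\<^esub> ?f z" using dom adj_in_verts by blast
      with x show "y \<in> (\<Union>x\<in>?f ` S. out_nbrs ?H x)"
        unfolding out_nbrs_def by blast
    qed
    have "sources G \<subseteq> verts G" "(\<Union>x\<in>sources G. out_nbrs G x) \<subseteq> verts G"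
      using adj_in_verts by (auto simp: sources_def out_nbrs_def)
    then show ?thesis
      unfolding out_nbrs_set_def src
      using * inj_on_image_set_diff[OF inj, of "\<Union>x\<in>sources G. out_nbrs G x" "sources G"]
      by auto
  qed
  obtain K where K: "quasi_kernel G K" and le: "real (card K) \<le>
       (real (card (verts G)) + real (card (sources G))
          - real (card (out_nbrs_set G (sources G)))) / 2"
    using \<open>good G\<close> by (auto simp: good_def)
  have KG: "K \<subseteq> verts G" using K by (auto simp: quasi_kernel_def independent_verts_def)
  have card: "card (?f ` X) = card X" if "X \<subseteq> verts G" for X
    using inj that by (meson card_image inj_on_subset)
  have "set_vdist ?H (?f ` K) (?f v) \<le> 2" if "v \<in> verts G" "v \<notin> K" for v
  proof -
    have "set_vdist ?H (?f ` K) (?f v) \<le> set_vdist G K v"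
      unfolding set_vdist_def image_image by (rule INF_mono) (use dist in blast)
    with K that show ?thesis by (auto simp: quasi_kernel_def intro: order_trans)
  qed
  moreover have "independent_verts ?H (?f ` K)"
    using K KG dom by (auto simp: quasi_kernel_def independent_verts_def subset_iff)
  ultimately have "quasi_kernel ?H (?f ` K)"
    unfolding quasi_kernel_def by auto
  moreover have "sources G \<subseteq> verts G" "out_nbrs_set G (sources G) \<subseteq> verts G"
    using adj_in_verts by (auto simp: sources_def out_nbrs_def out_nbrs_set_def)
  ultimately show ?thesis
    unfolding good_def nbr unfolding src verts_app_iso
    using le KG by (intro exI[of _ "?f ` K"]) (simp add: card)
qed

lemma nat_copy:
  fixes G :: "('a, 'b) pre_digraph"
  assumes "digraph G"
  obtains H :: "(nat, nat \<times> nat) pre_digraph"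
  where "digraph_iso G H" "digraph H" "card (verts H) = card (verts G)" "good H \<longleftrightarrow> good G"
proof -
  interpret digraph G by fact
  obtain f :: "'a \<Rightarrow> nat" where f: "inj_on f (verts G)"
    using finite_imp_inj_to_nat_seg[OF finite_verts] by blast
  define hom :: "('a, 'b, nat, nat \<times> nat) digraph_isomorphism" where
    "hom = \<lparr>iso_verts = f, iso_arcs = (\<lambda>e. (f (tail G e), f (head G e))),
            iso_head = snd, iso_tail = fst\<rparr>"
  have "inj_on (\<lambda>e. (f (tail G e), f (head G e))) (arcs G)"
    using f no_multi_arcs by (auto intro!: inj_onI simp: arc_to_ends_def inj_on_eq_iff)
  then have hom: "digraph_isomorphism hom"
    using f wf_digraph by (auto simp: digraph_isomorphism_def hom_def)
  interpret H: fin_digraph "app_iso hom G" using hom ..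
  have H: "digraph (app_iso hom G)"
  proof unfold_locales
    fix e assume "e \<in> arcs (app_iso hom G)"
    then show "tail (app_iso hom G) e \<noteq> head (app_iso hom G) e"
      using f no_loops by (auto simp: hom_def inj_on_eq_iff)
  qed (auto simp: hom_def arc_to_ends_def)
  have "good (app_iso hom G)" if "good G"
    using good_app_iso[OF wf_digraph hom that] .
  moreover have "good G" if "good (app_iso hom G)"
    using good_app_iso[OF H.wf_digraph digraph_isomorphism_invI[OF hom] that] hom by simp
  moreover have "card (verts (app_iso hom G)) = card (verts G)"
    using f by (simp add: hom_def card_image)
  ultimately show ?thesis
    using that[of "app_iso hom G"] H hom by (auto simp: digraph_iso_def)
qed

end

theory Submission
  imports Defs
begin

text \<open>Let \<open>S\<close> be the set of sources of a minimal bad digraph, \<open>R\<close> its out-neighbourhood, \<open>D'\<close> the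
  digraph \<open>D - S - R\<close> and \<open>S'\<close> the set of sources of \<open>D'\<close>. Adding \<open>S\<close> to a small quasi-kernel of
  \<open>D'\<close> works if \<open>S'\<close> has at most as many elements as its out-neighbourhood \<open>N'\<close> in \<open>D'\<close>. Otherwise
  add \<open>S\<close> to a small quasi-kernel of \<open>D' - S'\<close>: every vertex of \<open>S'\<close> has an in-neighbour in \<open>R\<close>, so
  it is at distance two from \<open>S\<close>, and the sources of \<open>D' - S'\<close> all lie in the small set \<open>N'\<close>.\<close>

lemma induce_subgraph_dominates_iff:
  "u \<rightarrow>\<^bsub>G \<restriction> X\<^esub> v \<longleftrightarrow> u \<in> X \<and> v \<in> X \<and> u \<rightarrow>\<^bsub>G\<^esub> v"
  by (auto simp: arcs_ends_def arc_to_ends_def image_iff)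

lemma (in wf_digraph) vdist_le_length_awalk:
  assumes "awalk u p v"
  shows "vdist G u v \<le> ereal (real (length p))"
  using min_cost_le_walk_cost[OF assms, of "\<lambda>_. 1"]
  by (simp add: vdist_def awalk_cost_def sum_list_triv)

lemma (in wf_digraph) vdist_le_1:
  assumes "u \<rightarrow>\<^bsub>G\<^esub> v"
  shows "vdist G u v \<le> 1"
proof -
  obtain e where "e \<in> arcs G" "tail G e = u" "head G e = v"
    using assms by (auto simp: arcs_ends_def arc_to_ends_def)
  then have "awalk u [e] v" by (auto simp: awalk_simps)
  from vdist_le_length_awalk[OF this] show ?thesis by (simp add: one_ereal_def)
qed

lemma (in wf_digraph) vdist_le_2:
  assumes "u \<rightarrow>\<^bsub>G\<^esub> w" "w \<rightarrow>\<^bsub>G\<^esub> v"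
  shows "vdist G u v \<le> 2"
proof -
  obtain e f where "e \<in> arcs G" "tail G e = u" "head G e = w"
     "f \<in> arcs G" "tail G f = w" "head G f = v"
    using assms by (auto simp: arcs_ends_def arc_to_ends_def)
  then have "awalk u [e, f] v" by (auto simp: awalk_simps)
  from vdist_le_length_awalk[OF this] show ?thesis by simp
qed

lemma (in wf_digraph) vdist_induce_subgraph:
  assumes "X \<subseteq> verts G"
  shows "vdist G u v \<le> vdist (G \<restriction> X) u v"
proof -
  interpret H: wf_digraph "G \<restriction> X" by (rule wellformed_induce_subgraph)
  have sub: "subgraph (G \<restriction> X) G"
    using assms by (intro induced_imp_subgraph induced_induce)
  show ?thesis
    unfolding vdist_def H.\<mu>_def
  proof (rule INF_greatest)
    fix p assume "p \<in> {p. H.awalk u p v}"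
    then have "awalk u p v" using sub by (auto intro: subgraph_awalk_imp_awalk)
    from min_cost_le_walk_cost[OF this, of "\<lambda>_. 1"]
    show "\<mu> (\<lambda>_. 1) u v \<le> ereal (H.awalk_cost (\<lambda>_. 1) p)"
      by (simp add: awalk_cost_def H.awalk_cost_def)
  qed
qed

lemma set_vdist_le:
  assumes "x \<in> K" "vdist G x v \<le> c"
  shows "set_vdist G K v \<le> c"
  unfolding set_vdist_def using assms by (rule INF_lower2)

text \<open>Serves to add \<open>S\<close> to a quasi-kernel of a part of \<open>D\<close>. Every
  walk of \<open>G \<restriction> X\<close> is a walk of \<open>G\<close>, so the vertices of
  \<open>X\<close> stay within distance two of \<open>K\<close>. Those outside \<open>X\<close> are
  left to \<open>A\<close>, and \<open>sep\<close> excludes arcs between \<open>A\<close> and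
  \<open>K\<close>, since \<open>K\<close> lies in \<open>X\<close>.\<close>

lemma (in wf_digraph) quasi_kernel_Un_induce_subgraph:
  assumes X: "X \<subseteq> verts G" and A: "independent_verts G A"
    and sep: "\<And>a x. a \<in> A \<Longrightarrow> x \<in> X \<Longrightarrow> \<not> a \<rightarrow>\<^bsub>G\<^esub> x \<and> \<not> x \<rightarrow>\<^bsub>G\<^esub> a"
    and cover: "\<And>v. v \<in> verts G - X - A \<Longrightarrow> set_vdist G A v \<le> 2"
    and K: "quasi_kernel (G \<restriction> X) K"
  shows "quasi_kernel G (A \<union> K)"
proof -
  have KX: "K \<subseteq> X" and indep: "\<And>u v. u \<in> K \<Longrightarrow> v \<in> K \<Longrightarrow> \<not> u \<rightarrow>\<^bsub>G\<^esub> v"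
    using K by (auto simp: quasi_kernel_def independent_verts_def induce_subgraph_dominates_iff
        subset_iff)
  have "independent_verts G (A \<union> K)"
    using A KX X indep sep unfolding independent_verts_def by blast
  moreover have "set_vdist G (A \<union> K) v \<le> 2" if v: "v \<in> verts G - (A \<union> K)" for v
  proof (cases "v \<in> X")
    case True
    have "set_vdist G (A \<union> K) v \<le> set_vdist (G \<restriction> X) K v"
      unfolding set_vdist_def using vdist_induce_subgraph[OF X] by (intro INF_mono) blast
    also have "\<dots> \<le> 2" using K v True by (auto simp: quasi_kernel_def)
    finally show ?thesis .
  next
    case False
    have "set_vdist G (A \<union> K) v \<le> set_vdist G A v"
      unfolding set_vdist_def by (rule INF_superset_mono) auto
    also have "\<dots> \<le> 2" using cover v False by auto
    finally show ?thesis .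
  qed
  ultimately show ?thesis by (auto simp: quasi_kernel_def)
qed

lemma (in fin_digraph) sources_iff:
  "v \<in> sources G \<longleftrightarrow> v \<in> verts G \<and> (\<forall>u. \<not> u \<rightarrow>\<^bsub>G\<^esub> v)"
  by (auto simp: sources_def in_degree_def in_arcs_def arcs_ends_def arc_to_ends_def)

theorem theorem3:
  fixes D :: "('a, 'b) pre_digraph"
  assumes "digraph D" and "\<not> good D"
    and "\<And>H :: (nat, nat \<times> nat) pre_digraph.
           digraph H \<Longrightarrow> \<not> good H \<Longrightarrow> card (verts D) \<le> card (verts H)"
  shows "sources D = {}"
proof (rule ccontr)
  assume nonempty: "sources D \<noteq> {}"
  interpret digraph D by fact
  have dig: "digraph (D \<restriction> X)" if "X \<subseteq> verts D" for X
    using that by (intro digraphI_induced induced_induce)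
  have src: "v \<in> sources (D \<restriction> X) \<longleftrightarrow> v \<in> X \<and> (\<forall>u\<in>X. \<not> u \<rightarrow>\<^bsub>D\<^esub> v)"
    if "X \<subseteq> verts D" for X v
  proof -
    interpret H: digraph "D \<restriction> X" using that by (rule dig)
    show ?thesis by (auto simp: H.sources_iff induce_subgraph_dominates_iff)
  qed
  \<comment> \<open>Minimality is assumed over digraphs on \<open>nat\<close>, so it is applied to
    the copy of \<open>D \<restriction> X\<close> given by \<open>nat_copy\<close>, which has as
    many vertices and is equally bad.\<close>
  have good_sub: "good (D \<restriction> X)" if X: "X \<subset> verts D" for X
  proof (rule ccontr)
    assume bad: "\<not> good (D \<restriction> X)"
    from dig X have "digraph (D \<restriction> X)" by blast
    from nat_copy[OF this] obtain H :: "(nat, nat \<times> nat) pre_digraph"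
      where "digraph H" "card (verts H) = card X" "\<not> good H"
      using bad by (metis induce_subgraph_verts)
    with assms(3) psubset_card_mono[OF finite_verts X] show False by fastforce
  qed
  \<comment> \<open>In the terms of the overview, \<open>D \<restriction> X\<close> is
    \<open>D'\<close> and \<open>D \<restriction> Y\<close> is \<open>D' - S'\<close>.\<close>
  define S where "S = sources D"
  define R where "R = out_nbrs_set D S"
  define X where "X = verts D - S - R"
  define S' where "S' = sources (D \<restriction> X)"
  define N' where "N' = out_nbrs_set (D \<restriction> X) S'"
  define Y where "Y = X - S'"
  define S'' where "S'' = sources (D \<restriction> Y)"
  have S: "v \<in> S \<longleftrightarrow> v \<in> verts D \<and> (\<forall>u. \<not> u \<rightarrow>\<^bsub>D\<^esub> v)" for v
    by (simp add: S_def sources_iff)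
  have R: "v \<in> R \<longleftrightarrow> (\<exists>s\<in>S. s \<rightarrow>\<^bsub>D\<^esub> v)" for v
    using S by (auto simp: R_def out_nbrs_set_def out_nbrs_def)
  have S': "v \<in> S' \<longleftrightarrow> v \<in> X \<and> (\<forall>u\<in>X. \<not> u \<rightarrow>\<^bsub>D\<^esub> v)" for v
    unfolding S'_def by (rule src) (auto simp: X_def)
  have S'': "v \<in> S'' \<longleftrightarrow> v \<in> Y \<and> (\<forall>u\<in>Y. \<not> u \<rightarrow>\<^bsub>D\<^esub> v)" for v
    unfolding S''_def by (rule src) (auto simp: X_def Y_def)
  have N': "v \<in> N' \<longleftrightarrow> v \<in> X \<and> (\<exists>s\<in>S'. s \<rightarrow>\<^bsub>D\<^esub> v)" for v
    using S' by (auto simp: N'_def out_nbrs_set_def out_nbrs_def induce_subgraph_dominates_iff)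
  have "S \<noteq> {}" using nonempty by (simp add: S_def)
  have sub: "S \<subseteq> verts D" "R \<subseteq> verts D" "S \<inter> R = {}" "X \<subset> verts D" "Y \<subset> verts D"
    "S' \<subseteq> X" "N' \<subseteq> X"
  proof -
    show "S \<subseteq> verts D" using S by blast
    \<comment> \<open>Here the existence of a source enters: removing \<open>S\<close> loses a
      vertex, so minimality applies to the subgraphs on \<open>X\<close> and
      \<open>Y\<close>.\<close>
    then show "X \<subset> verts D" "Y \<subset> verts D" using \<open>S \<noteq> {}\<close> unfolding X_def Y_def by blast+
    show "R \<subseteq> verts D" using R adj_in_verts(2) by blast
    show "S \<inter> R = {}" using S R by blast
    show "S' \<subseteq> X" "N' \<subseteq> X" using S' N' by blast+
  qed
  have "finite X" using sub(4) finite_verts by (meson finite_subset psubset_imp_subset)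
  then have fin: "finite S" "finite R" "finite X" "finite S'" "finite N'"
    using sub(1,2,6,7) finite_verts by (simp_all add: finite_subset)
  have indep: "independent_verts D S"
    using S unfolding independent_verts_def by blast
  have coverR: "set_vdist D S v \<le> 2" if v: "v \<in> R" for v
  proof -
    obtain s where s: "s \<in> S" "s \<rightarrow>\<^bsub>D\<^esub> v" using v unfolding R by blast
    have "vdist D s v \<le> 1" using s by (intro vdist_le_1)
    also have "\<dots> \<le> (2 :: ereal)" by simp
    finally show ?thesis using s by (intro set_vdist_le)
  qed
  have coverS': "set_vdist D S v \<le> 2" if v: "v \<in> S'" for v
  proof -
    have "v \<notin> S" "v \<notin> R" using v sub by (auto simp: X_def)
    then obtain u where u: "u \<rightarrow>\<^bsub>D\<^esub> v" using v unfolding S S' X_def by blast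
    \<comment> \<open>Of the three parts of \<open>verts D\<close>, \<open>u\<close> is not in
      \<open>S\<close> because \<open>v\<close> is not in \<open>R\<close>, and not in
      \<open>X\<close> because \<open>v\<close> is a source of
      \<open>D \<restriction> X\<close>.\<close>
    have "u \<in> R"
      using u v \<open>v \<notin> R\<close> adj_in_verts(1)[OF u] by (auto simp: S' R X_def)
    then obtain s where "s \<in> S" "s \<rightarrow>\<^bsub>D\<^esub> u" unfolding R by blast
    with u show ?thesis by (intro set_vdist_le vdist_le_2)
  qed
  \<comment> \<open>Used with \<open>Z = X\<close> and with \<open>Z = Y\<close>. Outside
    \<open>Z\<close> and \<open>S\<close> only vertices of \<open>R\<close> and \<open>S'\<close>
    can remain, and \<open>S\<close> reaches both within two steps.\<close>
  have extend: "quasi_kernel D (S \<union> K)"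
    if "Z \<subseteq> X" "X - Z \<subseteq> S'" "quasi_kernel (D \<restriction> Z) K" for Z K
  proof (rule quasi_kernel_Un_induce_subgraph)
    show "Z \<subseteq> verts D" using that(1) sub by blast
    \<comment> \<open>Heads of arcs from \<open>S\<close> lie in \<open>R\<close>, which is disjoint
      from \<open>X\<close>; no arc enters a source.\<close>
    show "\<not> a \<rightarrow>\<^bsub>D\<^esub> x \<and> \<not> x \<rightarrow>\<^bsub>D\<^esub> a" if "a \<in> S" "x \<in> Z" for a x
      using that \<open>Z \<subseteq> X\<close> by (auto simp: X_def R) (auto simp: S)
    show "set_vdist D S v \<le> 2" if "v \<in> verts D - Z - S" for v
      using that \<open>X - Z \<subseteq> S'\<close> coverR coverS' unfolding X_def by blast
  qed (use indep that in auto)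
  have cardX: "real (card X) = real (card (verts D)) - card S - card R"
  proof -
    have "card (verts D) = card (X \<union> S \<union> R)"
      using sub by (intro arg_cong[of _ _ card]) (auto simp: X_def)
    also have "\<dots> = card X + card S + card R"
      using sub fin by (subst card_Un_disjoint; (subst card_Un_disjoint)?) (auto simp: X_def)
    finally show ?thesis by simp
  qed
  have cardY: "real (card Y) = real (card X) - card S'"
    using sub fin by (simp add: Y_def card_Diff_subset card_mono of_nat_diff)
  have bad: "real (card (S \<union> K)) > (real (card (verts D)) + card S - card R) / 2"
    if "quasi_kernel D (S \<union> K)" for K
    using that \<open>\<not> good D\<close> unfolding good_def S_def R_def by fastforce
  have cardUn: "real (card (S \<union> K)) \<le> real (card S) + card K" for K
    using card_Un_le[of S K] by linarith
  show False
  proof (cases "card S' \<le> card N'")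
    case True
    obtain K where "quasi_kernel (D \<restriction> X) K"
      and "real (card K) \<le> (real (card X) + card S' - card N') / 2"
      using good_sub[of X] sub by (auto simp: good_def S'_def N'_def)
    \<comment> \<open>As |S'| \<le> |N'|, the union has at most |S| + |X|/2 vertices. With |X| = n -
      |S| - |R|, where n is \<open>card (verts D)\<close>, this is (n + |S| - |R|)/2, against
      \<open>bad\<close>.\<close>
    then show False
      using bad[OF extend[of X K]] True cardUn[of K] cardX by simp
  next
    case False
    have "S'' \<subseteq> N'"
    proof
      fix v assume v: "v \<in> S''"
      then have "v \<in> X" "v \<notin> S'" by (auto simp: S'' Y_def)
      \<comment> \<open>\<open>v\<close> is a source of \<open>D \<restriction> Y\<close> but not of
        \<open>D \<restriction> X\<close>, so all its in-neighbours in \<open>X\<close> were removed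
        with \<open>S'\<close>.\<close>
      then obtain u where "u \<in> X" "u \<rightarrow>\<^bsub>D\<^esub> v" unfolding S' by blast
      with v have "u \<in> S'" by (auto simp: S'' Y_def)
      with \<open>v \<in> X\<close> \<open>u \<rightarrow>\<^bsub>D\<^esub> v\<close> show "v \<in> N'" by (auto simp: N')
    qed
    then have "card S'' \<le> card S'" using False card_mono[OF fin(5), of S''] by simp
    moreover obtain K where K: "quasi_kernel (D \<restriction> Y) K"
      and "real (card K) \<le> (real (card Y) + card S'' - card (out_nbrs_set (D \<restriction> Y) S'')) / 2"
      using good_sub[of Y] sub by (auto simp: good_def S''_def)
    moreover have "quasi_kernel D (S \<union> K)"
      using K by (rule extend[rotated 2]) (auto simp: Y_def)
    \<comment> \<open>Removing \<open>S'\<close> saves at least as much as the new sources cost: |Y|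
      + |S''| = |X| - |S'| + |S''| \<le> |X|, so the union again has at most |S| + |X|/2
      vertices.\<close>
    ultimately show False
      using bad[of K] cardUn[of K] cardX cardY by (simp add: field_simps)
  qed
qed

end
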